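(* Let $h$ and $F$ be as in the context, and suppose: $\nabla F$ is $L_{\nabla F}$-Lipschitz; $h$ is $(\mu,L)$-regular (nonsmooth sense) for $F$ with unique minimizer $z^\star$ over $\operatorname{Im}F$; and $F$ is strongly aligned at $z^\star$ with function $\delta$ and constant $s>0$. Let $x_0\in\mathbf{E}$ be such that $z_0=F(x_0)$ satisfies $\|z_0-z^\star\|\le \delta\left(\frac{\mu}{8L}\right)$. Then the following two statements hold. 1. (Polyak stepsize) Suppose $(x_k)_{k\ge0}$ is generated by the LMM subgradient method started at $x_0$ with the Polyak configuration with parameters $\gamma, C_{\mathtt{lb}}, C_{\mathtt{ub}}$, where $\gamma\le\min\left\{1,\frac{C_{\mathtt{lb}}}{L_{\nabla F}}\right\}$, and assume further that $\|z_0-z^\star\|\le\frac{s\mu}{8C_{\mathtt{ub}}L}$. Then $z_k=F(x_k)$ satisfies $$\|z_k-z^\star\|^2\le\left(1-\frac{\gamma\mu^2}{8L^2}\right)^{k}\|z_0-z^\star\|^2\quad\text{for all }k\ge0.$$ 2. (Geometrically decaying stepsize) Let $M=\delta\left(\frac{\mu}{8L}\right)$. Suppose $(x_k)_{k\ge0}$ is generated by the LMM subgradient method started at $x_0$ with $\gamma_k=\gamma q^k$, $\lambda_k=\lambda q^k$, where $\gamma,\lambda>0$, $q\in(0,1)$ satisfy $$\lambda\le\frac{s}{32}\frac{\mu}{L},\qquad \gamma\le\frac1L\min\left\{\frac{M\mu}{64L},\sqrt{\frac{2\lambda M}{L_{\nabla F}}},\frac{\lambda\mu}{2L_{\nabla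 F}L}\right\},\qquad q\ge\max\left\{1-\frac{\gamma\mu}{4M},\frac1{\sqrt2}\right\}.$$ Then $z_k=F(x_k)$ satisfies $\|z_k-z^\star\|\le Mq^k$ for all $k\ge0$.
   Context: Setting. $\mathbf{E},\mathbf{Y}$ are finite-dimensional Euclidean spaces with inner products $\langle\cdot,\cdot\rangle$ and induced norms $\|\cdot\|$; $h:\mathbf{Y}\to\mathbb{R}$ is convex and $F:\mathbf{E}\to\mathbf{Y}$ is continuously differentiable. $\nabla F(x):\mathbf{E}\to\mathbf{Y}$ is the derivative (Jacobian) and $\nabla F(x)^\top$ its adjoint. $\partial h$ is the convex subdifferential. $\mathbb{R}_+$ denotes the positive reals, $B_r(z)$ the closed ball of radius $r$, and $1/0=+\infty$. $h^\star$ and $\mathcal{Z}^\star$ are the minimum value and the set of minimizers of $h$ over $\operatorname{Im}F$. $\Pi^x$ is the orthogonal projection onto the range of $\nabla F(x)$. Fix for each $x$ an SVD of $\nabla F(x)$ with singular values $\sigma^x_1\ge\sigma^x_2\ge\cdots$; $\Pi^x_j$ is the orthogonal projection onto the span of the top $j$ left singular vectors. For $\lambda>0$, $P(x,\lambda)=\nabla F(x)(\nabla F(x)^\top\nabla F(x)+\lambda I)^{-1}\nabla F(x)^\top$. LMM (Levenberg-Morrison-Marquardt) subgradient method. Given $x_0\in\mathbf{E}$, stepsizes $\gamma_k>0$ and damping coefficients $\lambda_k>0$: for $k\ge0$ pick any $v_k\in\partial h(F(x_k))$ and set $x_{k+1}=x_k-\gamma_k(\nabla F(x_k)^\top\nabla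 F(x_k)+\lambda_kI)^{-1}\nabla F(x_k)^\top v_k$. Write $z_k=F(x_k)$. Polyak configuration with parameters $\gamma>0$, $0<C_{\mathtt{lb}}\le C_{\mathtt{ub}}$: $\gamma_k=\gamma\frac{h(z_k)-h^\star}{\|\Pi^{x_k}v_k\|^2}$ and $C_{\mathtt{lb}}\operatorname{dist}(z_k,\mathcal{Z}^\star)\le\lambda_k\le C_{\mathtt{ub}}\operatorname{dist}(z_k,\mathcal{Z}^\star)$ for all $k$. $\nabla F$ is $L_{\nabla F}$-Lipschitz ($L_{\nabla F}\ge0$): $\|\nabla F(x)-\nabla F(y)\|_{\mathrm{op}}\le L_{\nabla F}\|x-y\|$ for all $x,y\in\mathbf{E}$. $F$ is strongly aligned at $z^\star\in\operatorname{Im}F$ with function $\delta:\mathbb{R}_+\to\mathbb{R}_+$ and constant $s>0$: for any $\rho>0$ and any $z=F(x)\in B_{\delta(\rho)}(z^\star)$ there is an index $j$ with $\|(I-\Pi^x_j)(z-z^\star)\|\le\rho\|z-z^\star\|$ and $(\sigma^x_j)^2\ge s$. $h$ is $(\mu,L)$-regular (nonsmooth sense) for $F$ ($\mu,L>0$): (1) $h$ has a unique minimizer $z^\star$ over $\operatorname{Im}F$; (2) $h$ is convex; (3) $h(z)-h^\star\ge\mu\|z-z^\star\|$ for all $z\in\operatorname{Im}F$; (4a) $\|\Pi^xv\|\le L$ for all $x\in\mathbf{E}$ and $v\in\partial h(F(x))$; (4b) for all $x\in\mathbf{E}$, $z=F(x)$, $v\in\partial h(F(x))$ and $\lambda>0$,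 $|\langle v,(I-P(x,\lambda))(z-z^\star)\rangle|\le L\|(I-P(x,\lambda))(z-z^\star)\|$. *)

theory Defs
  imports "HOL-Analysis.Analysis"
begin

definition subdifferential :: "('a::real_inner \<Rightarrow> real) \<Rightarrow> 'a \<Rightarrow> 'a set" where
  "subdifferential h z = {v. \<forall>y. h y \<ge> h z + inner v (y - z)}"

definition orth_proj :: "'a::euclidean_space set \<Rightarrow> 'a \<Rightarrow> 'a" where
  "orth_proj S y = (THE p. p \<in> S \<and> (\<forall>w\<in>S. orthogonal (y - p) w))"

definition continuously_differentiable_with ::
  "('e::euclidean_space \<Rightarrow> 'y::euclidean_space) \<Rightarrow> ('e \<Rightarrow> 'e \<Rightarrow>\<^sub>L 'y) \<Rightarrow> bool" where
  "continuously_differentiable_with F DF \<longleftrightarrow>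
     (\<forall>x. (F has_derivative blinfun_apply (DF x)) (at x)) \<and> continuous_on UNIV DF"

text \<open>The infimum is a minimum whenever \<open>minimizers h F\<close> is nonempty.\<close>

definition min_value :: "('y \<Rightarrow> real) \<Rightarrow> ('e \<Rightarrow> 'y) \<Rightarrow> real" where
  "min_value h F = (INF z\<in>range F. h z)"

definition minimizers :: "('y \<Rightarrow> real) \<Rightarrow> ('e \<Rightarrow> 'y) \<Rightarrow> 'y set" where
  "minimizers h F = {z. is_arg_min h (\<lambda>z. z \<in> range F) z}"

definition damped_inverse ::
  "('e::euclidean_space \<Rightarrow>\<^sub>L 'y::euclidean_space) \<Rightarrow> real \<Rightarrow> 'e \<Rightarrow> 'e" where
  "damped_inverse A l = inv (\<lambda>w. adjoint (blinfun_apply A) (blinfun_apply A w) + l *\<^sub>R w)"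

definition damped_proj ::
  "('e::euclidean_space \<Rightarrow>\<^sub>L 'y::euclidean_space) \<Rightarrow> real \<Rightarrow> 'y \<Rightarrow> 'y" where
  "damped_proj A l y = blinfun_apply A (damped_inverse A l (adjoint (blinfun_apply A) y))"

text \<open>
  A (thin) singular value decomposition, with indices starting at 1:
  \<open>\<sigma> i\<close>, \<open>U i\<close> and \<open>V i\<close> are the singular values and the left and right singular vectors.
  Values at indices outside \<open>{1..min DIM('e) DIM('y)}\<close> are irrelevant.
\<close>

definition is_svd ::
  "('e::euclidean_space \<Rightarrow>\<^sub>L 'y::euclidean_space) \<Rightarrow>
     (nat \<Rightarrow> real) \<Rightarrow> (nat \<Rightarrow> 'y) \<Rightarrow> (nat \<Rightarrow> 'e) \<Rightarrow> bool" where
  "is_svd A \<sigma> U V \<longleftrightarrow>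
     (let J = {1..min DIM('e) DIM('y)} in
       (\<forall>i\<in>J. \<sigma> i \<ge> 0) \<and>
       (\<forall>i\<in>J. \<forall>j\<in>J. i \<le> j \<longrightarrow> \<sigma> j \<le> \<sigma> i) \<and>
       (\<forall>i\<in>J. \<forall>j\<in>J. inner (U i) (U j) = (if i = j then 1 else 0)) \<and>
       (\<forall>i\<in>J. \<forall>j\<in>J. inner (V i) (V j) = (if i = j then 1 else 0)) \<and>
       (\<forall>w. blinfun_apply A w = (\<Sum>i\<in>J. (\<sigma> i * inner (V i) w) *\<^sub>R U i)))"

text \<open>
  The alignment condition depends on \<open>F\<close> only through its values and, at each \<open>x\<close>, the singular
  values \<open>\<sigma> x\<close> and left singular vectors \<open>U x\<close> of its derivative.
\<close>

definition strongly_aligned ::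
  "('e::euclidean_space \<Rightarrow> 'y::euclidean_space) \<Rightarrow> ('e \<Rightarrow> nat \<Rightarrow> real) \<Rightarrow> ('e \<Rightarrow> nat \<Rightarrow> 'y) \<Rightarrow>
     'y \<Rightarrow> (real \<Rightarrow> real) \<Rightarrow> real \<Rightarrow> bool" where
  "strongly_aligned F \<sigma> U zs \<delta> s \<longleftrightarrow>
     zs \<in> range F \<and> (\<forall>\<rho>>0. \<delta> \<rho> > 0) \<and> s > 0 \<and>
     (\<forall>\<rho>>0. \<forall>x. F x \<in> cball zs (\<delta> \<rho>) \<longrightarrow>
        (\<exists>j\<in>{1..min DIM('e) DIM('y)}.
           norm ((F x - zs) - orth_proj (span (U x ` {1..j})) (F x - zs)) \<le> \<rho> * norm (F x - zs) \<and>
           (\<sigma> x j)\<^sup>2 \<ge> s))"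

definition nonsmooth_regular ::
  "('y::euclidean_space \<Rightarrow> real) \<Rightarrow> ('e::euclidean_space \<Rightarrow> 'y) \<Rightarrow> ('e \<Rightarrow> 'e \<Rightarrow>\<^sub>L 'y) \<Rightarrow>
     'y \<Rightarrow> real \<Rightarrow> real \<Rightarrow> bool" where
  "nonsmooth_regular h F DF zs \<mu> L \<longleftrightarrow>
     \<mu> > 0 \<and> L > 0 \<and>
     minimizers h F = {zs} \<and>
     convex_on UNIV h \<and>
     (\<forall>z\<in>range F. h z - min_value h F \<ge> \<mu> * norm (z - zs)) \<and>
     (\<forall>x. \<forall>v\<in>subdifferential h (F x).
        norm (orth_proj (range (blinfun_apply (DF x))) v) \<le> L) \<and>
     (\<forall>x. \<forall>v\<in>subdifferential h (F x). \<forall>l>0.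
        \<bar>inner v ((F x - zs) - damped_proj (DF x) l (F x - zs))\<bar>
          \<le> L * norm ((F x - zs) - damped_proj (DF x) l (F x - zs)))"

definition lmm_sequence ::
  "('y::euclidean_space \<Rightarrow> real) \<Rightarrow> ('e::euclidean_space \<Rightarrow> 'y) \<Rightarrow> ('e \<Rightarrow> 'e \<Rightarrow>\<^sub>L 'y) \<Rightarrow> 'e \<Rightarrow>
     (nat \<Rightarrow> real) \<Rightarrow> (nat \<Rightarrow> real) \<Rightarrow> (nat \<Rightarrow> 'y) \<Rightarrow> (nat \<Rightarrow> 'e) \<Rightarrow> bool" where
  "lmm_sequence h F DF x0 gam lam v x \<longleftrightarrow>
     x 0 = x0 \<and>
     (\<forall>k. gam k > 0 \<and> lam k > 0 \<and>
        v k \<in> subdifferential h (F (x k)) \<and>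
        x (Suc k) = x k - gam k *\<^sub>R
          damped_inverse (DF (x k)) (lam k) (adjoint (blinfun_apply (DF (x k))) (v k)))"

text \<open>
  If the denominator vanishes, HOL's division gives \<open>gam k = 0\<close>, which is not an admissible
  stepsize: \<open>lmm_sequence\<close> requires \<open>gam k > 0\<close>.
\<close>

definition polyak_configuration ::
  "('y::euclidean_space \<Rightarrow> real) \<Rightarrow> ('e::euclidean_space \<Rightarrow> 'y) \<Rightarrow> ('e \<Rightarrow> 'e \<Rightarrow>\<^sub>L 'y) \<Rightarrow>
     real \<Rightarrow> real \<Rightarrow> real \<Rightarrow>
     (nat \<Rightarrow> real) \<Rightarrow> (nat \<Rightarrow> real) \<Rightarrow> (nat \<Rightarrow> 'y) \<Rightarrow> (nat \<Rightarrow> 'e) \<Rightarrow> bool" where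
  "polyak_configuration h F DF \<gamma> Clb Cub gam lam v x \<longleftrightarrow>
     \<gamma> > 0 \<and> 0 < Clb \<and> Clb \<le> Cub \<and>
     (\<forall>k. gam k = \<gamma> * ((h (F (x k)) - min_value h F) /
                       (norm (orth_proj (range (blinfun_apply (DF (x k)))) (v k)))\<^sup>2)) \<and>
     (\<forall>k. Clb * infdist (F (x k)) (minimizers h F) \<le> lam k \<and>
          lam k \<le> Cub * infdist (F (x k)) (minimizers h F))"

text \<open>
  Bounds with the Lipschitz constant in the denominator are read in \<open>ereal\<close>, where
  \<open>ereal a / 0 = \<infinity>\<close> for \<open>a > 0\<close>; the square root is extended by \<open>\<surd>\<infinity> = \<infinity>\<close>.
\<close>

definition ereal_sqrt :: "ereal \<Rightarrow> ereal" where
  "ereal_sqrt a = (if a = \<infinity> then \<infinity> else ereal (sqrt (real_of_ereal a)))"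

end

theory Submission
  imports Defs
begin

text \<open>
  Write \<open>A\<close> for the derivative of \<open>F\<close> at the current iterate, \<open>e = F x - zs\<close>, \<open>E = norm e\<close>, and
  \<open>P = A (A\<^sup>T A + l I)\<^bsup>-1\<^esup> A\<^sup>T\<close>. To first order, a step of the method moves \<open>F x\<close> by \<open>- g * P v\<close>, where
  \<open>g\<close> is the step size and \<open>v\<close> a subgradient: it is a preconditioned subgradient step in the image
  space. If \<open>P\<close> were the identity, convexity and sharp growth would give the usual linear convergence.
  Three estimates show that the deviation from this case is harmless.

  The direction is good (\<open>damped_inner_lower_bound\<close>, \<open>aligned_residual_bound\<close>): as \<open>P\<close> is symmetric,
  \<open>inner (P v) e = inner v e - inner v (e - P e)\<close>, where the first term is at least the gap in \<open>h\<close>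
  and the second at most \<open>L * norm (e - P e)\<close>. Alignment puts \<open>e\<close>, up to a fraction
  \<open>\<rho> = \<mu> / (8 * L)\<close>, into the span of singular directions with \<open>\<sigma>\<^sup>2 \<ge> s\<close>, on which
  \<open>norm (p - P p) \<le> l / s * norm p\<close>. So the loss is at most \<open>L * (l / s + \<rho>) * E\<close>, a small fraction
  of the gap when \<open>l / s\<close> is of order \<open>\<mu> / L\<close>.

  The direction is short (\<open>damped_step_bounds\<close>): the norm of \<open>P v\<close> is at most that of the orthogonal
  projection of \<open>v\<close> onto the range of \<open>A\<close>, which is at most \<open>L\<close>.

  The linearization is accurate (\<open>lipschitz_derivative_remainder\<close>): the squared length of the step in
  the parameter space is at most \<open>g\<^sup>2 * N\<^sup>2 / (4 * l)\<close>, where \<open>N\<close> is the norm of that orthogonal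
  projection. So the error is at most \<open>LF * g\<^sup>2 * N\<^sup>2 / (8 * l)\<close>; the upper bound on the step size
  makes it small compared to the decrease of the exact step.

  Together these give the recursion \<open>aligned_lmm_step\<close>. For the Polyak step size it yields a
  contraction of the distance in each step (\<open>polyak_step\<close>), which also keeps the iterates in the
  region of alignment. For the geometric step size the invariant is \<open>E \<le> M * q ^ k\<close>
  (\<open>geometric_step\<close>): from within half the radius the iterate stays in the next ball because the step is short, and
  from farther away the step makes enough progress.
\<close>

section \<open>Orthogonal projections and adjoints\<close>

lemma orth_proj_subspace:
  fixes S :: "'a::euclidean_space set"
  assumes "subspace S"
  shows orth_proj_in: "orth_proj S y \<in> S"
    and orth_proj_orthogonal: "w \<in> S \<Longrightarrow> inner (y - orth_proj S y) w = 0"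
proof -
  have ex: "\<exists>!p. p \<in> S \<and> (\<forall>w\<in>S. orthogonal (y - p) w)"
  proof (rule ex_ex1I)
    obtain p z where "p \<in> span S" "\<And>w. w \<in> span S \<Longrightarrow> orthogonal z w" "y = p + z"
      using orthogonal_subspace_decomp_exists[of S y] by blast
    then show "\<exists>p. p \<in> S \<and> (\<forall>w\<in>S. orthogonal (y - p) w)"
      using assms by (intro exI[of _ p]) (simp add: span_eq_iff[THEN iffD2])
  next
    fix p p' assume p: "p \<in> S \<and> (\<forall>w\<in>S. orthogonal (y - p) w)"
      and p': "p' \<in> S \<and> (\<forall>w\<in>S. orthogonal (y - p') w)"
    then have "p - p' \<in> S" using assms by (simp add: subspace_diff)
    then have "inner (y - p) (p - p') = 0" "inner (y - p') (p - p') = 0"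
      using p p' by (auto simp: orthogonal_def)
    then have "inner (p - p') (p - p') = 0"
      by (simp add: inner_diff_left)
    then show "p = p'" by simp
  qed
  show "orth_proj S y \<in> S" "w \<in> S \<Longrightarrow> inner (y - orth_proj S y) w = 0"
    using theI'[OF ex] unfolding orth_proj_def orthogonal_def by auto
qed

lemma inner_orth_proj_eq:
  fixes S :: "'a::euclidean_space set"
  assumes "subspace S" "w \<in> S"
  shows "inner (orth_proj S y) w = inner y w"
  using orth_proj_orthogonal[OF assms, of y] by (simp add: inner_diff_left)

lemma subspace_range_blinfun: "subspace (range (blinfun_apply A))"
  by (rule linear_subspace_image) (auto intro: blinfun.bounded_linear_right bounded_linear.linear)

lemma inner_adjoint_blinfun:
  fixes A :: "'e::euclidean_space \<Rightarrow>\<^sub>L 'y::euclidean_space"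
  shows "inner (adjoint (blinfun_apply A) y) w = inner y (blinfun_apply A w)"
    and "inner w (adjoint (blinfun_apply A) y) = inner (blinfun_apply A w) y"
  by (simp_all add: adjoint_clauses bounded_linear.linear blinfun.bounded_linear_right)

lemma linear_adjoint_blinfun:
  fixes A :: "'e::euclidean_space \<Rightarrow>\<^sub>L 'y::euclidean_space"
  shows "linear (adjoint (blinfun_apply A))"
  by (simp add: adjoint_linear bounded_linear.linear blinfun.bounded_linear_right)

section \<open>The damped projection\<close>

text \<open>
  The normal operator is linear, and pairing its value at \<open>w\<close> with \<open>w\<close> gives
  \<open>(norm (A w))\<^sup>2 + l * (norm w)\<^sup>2\<close>; so it is injective, hence bijective in finite dimension.
  This makes the \<open>inv\<close> in \<^const>\<open>damped_inverse\<close> a genuine inverse.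
\<close>
lemma damped_normal_bij:
  fixes A :: "'e::euclidean_space \<Rightarrow>\<^sub>L 'y::euclidean_space"
  assumes "l > 0"
  shows "bij (\<lambda>w. adjoint (blinfun_apply A) (blinfun_apply A w) + l *\<^sub>R w)" (is "bij ?T")
proof -
  have lin: "linear ?T"
    by (rule linearI)
      (simp_all add: blinfun.add_right blinfun.scaleR_right linear_add[OF linear_adjoint_blinfun]
        linear_scale[OF linear_adjoint_blinfun] algebra_simps)
  moreover have "inj ?T"
  proof (subst linear_injective_0[OF lin], intro allI impI)
    fix w assume "?T w = 0"
    then have "inner (?T w) w = 0" by simp
    then have "inner (blinfun_apply A w) (blinfun_apply A w) + l * inner w w = 0"
      by (simp add: inner_add_left inner_adjoint_blinfun)
    then have "l * inner w w = 0" using assms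
      by (smt (verit) inner_ge_zero mult_nonneg_nonneg)
    then show "w = 0" using assms by simp
  qed
  ultimately show ?thesis
    using linear_injective_imp_surjective by (auto simp: bij_def)
qed

lemma damped_inverse_solves:
  fixes A :: "'e::euclidean_space \<Rightarrow>\<^sub>L 'y::euclidean_space"
  assumes "l > 0"
  shows "adjoint (blinfun_apply A) (blinfun_apply A (damped_inverse A l b)) + l *\<^sub>R damped_inverse A l b = b"
  using surj_f_inv_f[OF bij_is_surj[OF damped_normal_bij[OF assms, of A]], of b]
  unfolding damped_inverse_def by simp

lemma damped_inverse_unique:
  fixes A :: "'e::euclidean_space \<Rightarrow>\<^sub>L 'y::euclidean_space"
  assumes "l > 0" "adjoint (blinfun_apply A) (blinfun_apply A w) + l *\<^sub>R w = b"
  shows "damped_inverse A l b = w"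
  using inv_f_f[OF bij_is_inj[OF damped_normal_bij[OF assms(1), of A]], of w] assms(2)
  unfolding damped_inverse_def by simp

text \<open>
  Symmetry moves the damped projection from the subgradient, where the algorithm applies it, to the
  error \<open>F x - zs\<close>, where alignment controls it.
\<close>
lemma damped_proj_symmetric:
  fixes A :: "'e::euclidean_space \<Rightarrow>\<^sub>L 'y::euclidean_space"
  assumes "l > 0"
  shows "inner (damped_proj A l v) y = inner v (damped_proj A l y)"
proof -
  define a b where "a = damped_inverse A l (adjoint (blinfun_apply A) v)"
    and "b = damped_inverse A l (adjoint (blinfun_apply A) y)"
  have a: "adjoint (blinfun_apply A) v = adjoint (blinfun_apply A) (blinfun_apply A a) + l *\<^sub>R a"
    and b: "adjoint (blinfun_apply A) y = adjoint (blinfun_apply A) (blinfun_apply A b) + l *\<^sub>R b"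
    unfolding a_def b_def using damped_inverse_solves[OF assms] by metis+
  have "inner (blinfun_apply A a) y = inner a (adjoint (blinfun_apply A) y)"
    by (simp add: inner_adjoint_blinfun)
  also have "\<dots> = inner (adjoint (blinfun_apply A) v) b"
    unfolding a b by (simp add: inner_add_left inner_add_right inner_adjoint_blinfun)
  also have "\<dots> = inner v (blinfun_apply A b)"
    by (simp add: inner_adjoint_blinfun)
  finally show ?thesis
    unfolding damped_proj_def a_def b_def .
qed

text \<open>
  The residual \<open>d = y - A w\<close> satisfies \<open>A\<^sup>T d = l w\<close>, so
  \<open>inner d (A w) = l * (norm w)\<^sup>2\<close> is nonnegative: the fitted part and the residual make an
  angle of at most ninety degrees. Thus both the damped projection and its complement are
  nonexpansive, without any spectral calculus.
\<close>
lemma damped_proj_Pythagoras: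
  fixes A :: "'e::euclidean_space \<Rightarrow>\<^sub>L 'y::euclidean_space"
  assumes "l > 0"
  shows "(norm (y - damped_proj A l y))\<^sup>2 + (norm (damped_proj A l y))\<^sup>2 \<le> (norm y)\<^sup>2"
proof -
  define w where "w = damped_inverse A l (adjoint (blinfun_apply A) y)"
  define d where "d = y - damped_proj A l y"
  have P: "damped_proj A l y = blinfun_apply A w"
    by (simp add: damped_proj_def w_def)
  have "adjoint (blinfun_apply A) d = l *\<^sub>R w"
    unfolding d_def P using damped_inverse_solves[OF assms, of A "adjoint (blinfun_apply A) y"]
    by (simp add: linear_diff[OF linear_adjoint_blinfun] w_def algebra_simps)
  then have "inner d (blinfun_apply A w) = l * inner w w"
    by (metis inner_adjoint_blinfun(1) inner_scaleR_left)
  then have "inner d (damped_proj A l y) \<ge> 0"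
    unfolding P using assms by simp
  moreover have "(norm (d + damped_proj A l y))\<^sup>2
      = (norm d)\<^sup>2 + 2 * inner d (damped_proj A l y) + (norm (damped_proj A l y))\<^sup>2"
    by (simp add: power2_norm_eq_inner inner_add_left inner_add_right inner_commute)
  moreover have "d + damped_proj A l y = y" by (simp add: d_def)
  ultimately show ?thesis by (simp add: d_def)
qed

lemma damped_proj_contractive:
  fixes A :: "'e::euclidean_space \<Rightarrow>\<^sub>L 'y::euclidean_space"
  assumes "l > 0"
  shows "norm (damped_proj A l y) \<le> norm y" "norm (y - damped_proj A l y) \<le> norm y"
proof -
  note Pyth = damped_proj_Pythagoras[OF assms, of y A]
  have "(norm (damped_proj A l y))\<^sup>2 \<le> (norm y)\<^sup>2" "(norm (y - damped_proj A l y))\<^sup>2 \<le> (norm y)\<^sup>2"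
    using Pyth zero_le_power2[of "norm (damped_proj A l y)"]
      zero_le_power2[of "norm (y - damped_proj A l y)"] by linarith+
  then show "norm (damped_proj A l y) \<le> norm y" "norm (y - damped_proj A l y) \<le> norm y"
    by (auto intro: power2_le_imp_le)
qed

lemma damped_proj_diff:
  fixes A :: "'e::euclidean_space \<Rightarrow>\<^sub>L 'y::euclidean_space"
  assumes "l > 0"
  shows "damped_proj A l (y - z) = damped_proj A l y - damped_proj A l z"
proof -
  let ?w = "\<lambda>y. damped_inverse A l (adjoint (blinfun_apply A) y)"
  have "?w (y - z) = ?w y - ?w z"
    by (rule damped_inverse_unique[OF assms])
      (use damped_inverse_solves[OF assms, of A "adjoint (blinfun_apply A) y"]
         damped_inverse_solves[OF assms, of A "adjoint (blinfun_apply A) z"] in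
        \<open>simp add: linear_diff[OF linear_adjoint_blinfun] blinfun.diff_right algebra_simps\<close>)
  then show ?thesis by (simp add: damped_proj_def blinfun.diff_right)
qed

text \<open>
  Pairing the normal equation with its solution \<open>w\<close> yields
  \<open>a\<^sup>2 + l * (norm w)\<^sup>2 \<le> N * a\<close> for \<open>a = norm (A w)\<close>, since only the part of \<open>v\<close> in the range
  of \<open>A\<close> is seen by \<open>A\<^sup>T\<close>. Maximizing \<open>N * a - a\<^sup>2\<close> over \<open>a\<close> bounds the step length, and dropping
  the second summand bounds \<open>a\<close>.
\<close>
lemma damped_step_bounds:
  fixes A :: "'e::euclidean_space \<Rightarrow>\<^sub>L 'y::euclidean_space" and v :: 'y
  assumes "l > 0"
  defines "w \<equiv> damped_inverse A l (adjoint (blinfun_apply A) v)"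
    and "N \<equiv> norm (orth_proj (range (blinfun_apply A)) v)"
  shows "l * (norm w)\<^sup>2 \<le> N\<^sup>2 / 4" "norm (damped_proj A l v) \<le> N"
proof -
  define a where "a = norm (blinfun_apply A w)"
  have "a\<^sup>2 + l * (norm w)\<^sup>2 = inner (adjoint (blinfun_apply A) v) w"
    by (subst damped_inverse_solves[OF assms(1), of A "adjoint (blinfun_apply A) v", symmetric])
      (simp add: w_def[symmetric] a_def inner_add_left inner_adjoint_blinfun power2_norm_eq_inner)
  also have "\<dots> = inner (orth_proj (range (blinfun_apply A)) v) (blinfun_apply A w)"
    by (simp add: inner_adjoint_blinfun inner_orth_proj_eq subspace_range_blinfun)
  also have "\<dots> \<le> N * a"
    unfolding N_def a_def by (rule norm_cauchy_schwarz)
  finally have le: "a\<^sup>2 + l * (norm w)\<^sup>2 \<le> N * a" .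
  have "0 \<le> (a - N / 2)\<^sup>2" by simp
  then show "l * (norm w)\<^sup>2 \<le> N\<^sup>2 / 4"
    using le by (simp add: power2_eq_square algebra_simps)
  have "a * a \<le> N * a"
  proof -
    have "0 \<le> l * (norm w)\<^sup>2" using assms(1) by simp
    then show ?thesis using le unfolding power2_eq_square[of a] by linarith
  qed
  moreover have "a \<ge> 0" "N \<ge> 0" by (simp_all add: a_def N_def)
  ultimately have "a \<le> N" by (cases "a = 0") auto
  then show "norm (damped_proj A l v) \<le> N"
    by (simp add: damped_proj_def a_def w_def)
qed

text \<open>
  On the range of \<open>A A\<^sup>T\<close> the damping error is of order \<open>l\<close>. Formally
  \<open>I - P = l * (A A\<^sup>T + l I)\<^bsup>-1\<^esup>\<close> and \<open>P = (A A\<^sup>T + l I)\<^bsup>-1\<^esup> A A\<^sup>T\<close>, whence \<open>(I - P) A A\<^sup>T = l P\<close>.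
\<close>
lemma damped_residual_on_normal_range:
  fixes A :: "'e::euclidean_space \<Rightarrow>\<^sub>L 'y::euclidean_space"
  assumes "l > 0" and p: "p = blinfun_apply A (adjoint (blinfun_apply A) u)"
  shows "p - damped_proj A l p = l *\<^sub>R damped_proj A l u"
proof -
  let ?At = "adjoint (blinfun_apply A)"
  define w where "w = damped_inverse A l (?At u)"
  have w: "?At (blinfun_apply A w) = ?At u - l *\<^sub>R w"
    using damped_inverse_solves[OF assms(1), of A "?At u"] unfolding w_def by (simp add: eq_diff_eq)
  have "damped_inverse A l (?At p) = ?At (blinfun_apply A w)"
  proof (rule damped_inverse_unique[OF assms(1)])
    have "?At (blinfun_apply A (?At (blinfun_apply A w)))
        = ?At p - l *\<^sub>R ?At (blinfun_apply A w)"
      by (subst w) (simp add: blinfun.diff_right blinfun.scaleR_right p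
          linear_diff[OF linear_adjoint_blinfun] linear_scale[OF linear_adjoint_blinfun])
    then show "?At (blinfun_apply A (?At (blinfun_apply A w))) + l *\<^sub>R ?At (blinfun_apply A w) = ?At p"
      by simp
  qed
  then have "damped_proj A l p = p - l *\<^sub>R blinfun_apply A w"
    by (simp add: damped_proj_def w blinfun.diff_right blinfun.scaleR_right p)
  then show ?thesis by (simp add: damped_proj_def w_def)
qed

section \<open>Singular vectors and alignment\<close>

lemma svd_adjoint_left:
  fixes A :: "'e::euclidean_space \<Rightarrow>\<^sub>L 'y::euclidean_space"
  assumes "is_svd A \<sigma> U V" and i: "i \<in> {1..min DIM('e) DIM('y)}"
  shows "blinfun_apply A (adjoint (blinfun_apply A) (U i)) = (\<sigma> i)\<^sup>2 *\<^sub>R U i"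
proof -
  let ?J = "{1..min DIM('e) DIM('y)}"
  have U: "inner (U i) (U k) = (if i = k then 1 else 0)" if "k \<in> ?J" for k
    using assms that unfolding is_svd_def Let_def by blast
  have V: "inner (V k) (V i) = (if k = i then 1 else 0)" if "k \<in> ?J" for k
    using assms that unfolding is_svd_def Let_def by blast
  have A: "blinfun_apply A w = (\<Sum>k\<in>?J. (\<sigma> k * inner (V k) w) *\<^sub>R U k)" for w
    using assms unfolding is_svd_def Let_def by blast
  have "inner (adjoint (blinfun_apply A) (U i)) w = inner (\<sigma> i *\<^sub>R V i) w" for w
  proof -
    have "inner (adjoint (blinfun_apply A) (U i)) w
        = (\<Sum>k\<in>?J. \<sigma> k * inner (V k) w * inner (U i) (U k))"
      by (simp add: inner_adjoint_blinfun A inner_sum_right)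
    also have "\<dots> = (\<Sum>k\<in>?J. if i = k then \<sigma> k * inner (V k) w else 0)"
      by (rule sum.cong) (simp_all add: U)
    also have "\<dots> = inner (\<sigma> i *\<^sub>R V i) w"
      using i by (simp add: sum.delta)
    finally show ?thesis .
  qed
  then have adj: "adjoint (blinfun_apply A) (U i) = \<sigma> i *\<^sub>R V i"
    using vector_eq_rdot by blast
  have "blinfun_apply A (V i) = (\<Sum>k\<in>?J. if k = i then \<sigma> k *\<^sub>R U k else 0)"
    unfolding A by (rule sum.cong) (simp_all add: V)
  also have "\<dots> = \<sigma> i *\<^sub>R U i"
    using i by (simp add: sum.delta)
  finally show ?thesis
    by (simp add: adj blinfun.scaleR_right power2_eq_square)
qed

lemma span_orthonormal_expansion:
  fixes U :: "'i \<Rightarrow> 'y::real_inner"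
  assumes "finite I" and U: "\<And>i k. i \<in> I \<Longrightarrow> k \<in> I \<Longrightarrow> inner (U i) (U k) = (if i = k then 1 else 0)"
    and "p \<in> span (U ` I)"
  shows "p = (\<Sum>i\<in>I. inner (U i) p *\<^sub>R U i)"
  using assms(3)
proof (induction rule: span_induct_alt)
  case base
  then show ?case by simp
next
  case (step c x y)
  then obtain k where k: "k \<in> I" "x = U k" by auto
  have "(\<Sum>i\<in>I. inner (U i) x *\<^sub>R U i) = (\<Sum>i\<in>I. if i = k then U i else 0)"
    by (rule sum.cong) (simp_all add: k U)
  also have "\<dots> = x" using k assms(1) by (simp add: sum.delta)
  finally have x: "(\<Sum>i\<in>I. inner (U i) x *\<^sub>R U i) = x" .
  have "(\<Sum>i\<in>I. inner (U i) (c *\<^sub>R x + y) *\<^sub>R U i)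
      = c *\<^sub>R (\<Sum>i\<in>I. inner (U i) x *\<^sub>R U i) + (\<Sum>i\<in>I. inner (U i) y *\<^sub>R U i)"
    by (simp add: inner_add_right scaleR_add_left sum.distrib scaleR_sum_right)
  also have "\<dots> = c *\<^sub>R x + y" by (simp only: x step.IH[symmetric])
  finally show ?case by simp
qed

lemma norm_orthonormal_sum:
  fixes U :: "'i \<Rightarrow> 'y::real_inner"
  assumes "finite I" and U: "\<And>i k. i \<in> I \<Longrightarrow> k \<in> I \<Longrightarrow> inner (U i) (U k) = (if i = k then 1 else 0)"
  shows "(norm (\<Sum>i\<in>I. c i *\<^sub>R U i))\<^sup>2 = (\<Sum>i\<in>I. (c i)\<^sup>2)"
proof -
  have "(norm (\<Sum>i\<in>I. c i *\<^sub>R U i))\<^sup>2 = (\<Sum>i\<in>I. (norm (c i *\<^sub>R U i))\<^sup>2)"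
    by (rule norm_sum_Pythagorean[OF assms(1)]) (auto simp: pairwise_def orthogonal_def U)
  also have "\<dots> = (\<Sum>i\<in>I. (c i)\<^sup>2)"
    by (rule sum.cong) (simp_all add: norm_eq_sqrt_inner U)
  finally show ?thesis .
qed

text \<open>
  On the span of the left singular vectors with \<open>(\<sigma> i)\<^sup>2 \<ge> s\<close>, the operator \<open>A A\<^sup>T\<close> is diagonal with
  entries at least \<open>s\<close>; dividing the coefficients of \<open>p\<close> by those entries gives the preimage.
\<close>
lemma top_singular_span_preimage:
  fixes A :: "'e::euclidean_space \<Rightarrow>\<^sub>L 'y::euclidean_space"
  assumes svd: "is_svd A \<sigma> U V" and j: "j \<in> {1..min DIM('e) DIM('y)}"
    and s: "s > 0" "(\<sigma> j)\<^sup>2 \<ge> s"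
    and p: "p \<in> span (U ` {1..j})"
  obtains u where "p = blinfun_apply A (adjoint (blinfun_apply A) u)" "s * norm u \<le> norm p"
proof -
  define I where "I = {1..j}"
  let ?J = "{1..min DIM('e) DIM('y)}"
  have IJ: "I \<subseteq> ?J" and fin: "finite I" using j by (auto simp: I_def)
  have U: "inner (U i) (U k) = (if i = k then 1 else 0)" if "i \<in> I" "k \<in> I" for i k
    using svd IJ that unfolding is_svd_def Let_def by blast
  have \<sigma>: "s \<le> (\<sigma> i)\<^sup>2" if "i \<in> I" for i
  proof -
    have "0 \<le> \<sigma> j" "\<sigma> j \<le> \<sigma> i"
      using svd j IJ that unfolding is_svd_def Let_def I_def by (auto simp del: One_nat_def)
    then show ?thesis using s(2) power_mono[of "\<sigma> j" "\<sigma> i" 2] by linarith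
  qed
  have expand: "p = (\<Sum>i\<in>I. inner (U i) p *\<^sub>R U i)"
    by (rule span_orthonormal_expansion[OF fin U]) (use p I_def in auto)
  define u where "u = (\<Sum>i\<in>I. (inner (U i) p / (\<sigma> i)\<^sup>2) *\<^sub>R U i)"
  have lin: "linear (\<lambda>y. blinfun_apply A (adjoint (blinfun_apply A) y))"
    using linear_compose[OF linear_adjoint_blinfun[of A] bounded_linear.linear[OF blinfun.bounded_linear_right[of A]]]
    by (simp add: o_def)
  have "blinfun_apply A (adjoint (blinfun_apply A) u)
      = (\<Sum>i\<in>I. (inner (U i) p / (\<sigma> i)\<^sup>2) *\<^sub>R blinfun_apply A (adjoint (blinfun_apply A) (U i)))"
    unfolding u_def by (simp add: linear_sum[OF lin] linear_scale[OF lin])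
  also have "\<dots> = (\<Sum>i\<in>I. inner (U i) p *\<^sub>R U i)"
  proof (rule sum.cong[OF refl])
    fix i assume i: "i \<in> I"
    then have "i \<in> ?J" using IJ by blast
    moreover have "(\<sigma> i)\<^sup>2 \<noteq> 0" using \<sigma>[OF i] s(1) by linarith
    ultimately show "(inner (U i) p / (\<sigma> i)\<^sup>2) *\<^sub>R blinfun_apply A (adjoint (blinfun_apply A) (U i))
        = inner (U i) p *\<^sub>R U i"
      by (simp only: svd_adjoint_left[OF svd] scaleR_scaleR) simp
  qed
  finally have 1: "p = blinfun_apply A (adjoint (blinfun_apply A) u)" using expand by simp
  have "(s * norm u)\<^sup>2 = s\<^sup>2 * (\<Sum>i\<in>I. (inner (U i) p / (\<sigma> i)\<^sup>2)\<^sup>2)"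
    unfolding u_def by (simp add: power_mult_distrib norm_orthonormal_sum[OF fin U])
  also have "\<dots> = (\<Sum>i\<in>I. (s / (\<sigma> i)\<^sup>2)\<^sup>2 * (inner (U i) p)\<^sup>2)"
    by (simp add: sum_distrib_left power_divide mult.commute)
  also have "\<dots> \<le> (\<Sum>i\<in>I. 1 * (inner (U i) p)\<^sup>2)"
  proof (rule sum_mono)
    fix i assume i: "i \<in> I"
    have "0 \<le> s / (\<sigma> i)\<^sup>2" "s / (\<sigma> i)\<^sup>2 \<le> 1"
      using \<sigma>[OF i] s(1) by (simp_all add: divide_le_eq)
    then have "(s / (\<sigma> i)\<^sup>2)\<^sup>2 \<le> 1" by (simp add: power_le_one)
    then show "(s / (\<sigma> i)\<^sup>2)\<^sup>2 * (inner (U i) p)\<^sup>2 \<le> 1 * (inner (U i) p)\<^sup>2"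
      by (intro mult_right_mono) simp_all
  qed
  also have "\<dots> = (norm p)\<^sup>2"
    by (subst (2) expand) (simp add: norm_orthonormal_sum[OF fin U])
  finally have "s * norm u \<le> norm p" by (rule power2_le_imp_le) simp
  with 1 show ?thesis by (rule that)
qed

text \<open>
  The error is split into its component \<open>p\<close> along the top singular directions and the rest. On \<open>p\<close> the
  damping loses only a fraction \<open>l / s\<close>, because the directions are well conditioned; the rest is
  a fraction \<open>\<rho>\<close> of the error by alignment and does not grow under \<open>I - P\<close>.
\<close>
lemma aligned_residual_bound:
  fixes A :: "'e::euclidean_space \<Rightarrow>\<^sub>L 'y::euclidean_space"
  assumes svd: "is_svd A \<sigma> U V" and j: "j \<in> {1..min DIM('e) DIM('y)}"
    and s: "s > 0" "(\<sigma> j)\<^sup>2 \<ge> s" and l: "l > 0"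
    and al: "norm (e - orth_proj (span (U ` {1..j})) e) \<le> \<rho> * norm e"
  shows "norm (e - damped_proj A l e) \<le> (l / s + \<rho>) * norm e"
proof -
  define p where "p = orth_proj (span (U ` {1..j})) e"
  have p: "p \<in> span (U ` {1..j})"
    unfolding p_def by (rule orth_proj_in[OF subspace_span])
  obtain u where u: "p = blinfun_apply A (adjoint (blinfun_apply A) u)" "s * norm u \<le> norm p"
    using top_singular_span_preimage[OF svd j s p] .
  have "inner (e - p) p = 0"
    using orth_proj_orthogonal[OF subspace_span p] by (simp add: p_def)
  then have "(norm p)\<^sup>2 = inner e p" by (simp add: power2_norm_eq_inner inner_diff_left)
  also have "\<dots> \<le> norm e * norm p" by (rule norm_cauchy_schwarz)
  finally have "norm p \<le> norm e"
    by (cases "p = 0") (auto simp: power2_eq_square)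
  then have su: "norm u \<le> norm e / s" using u(2) s(1) by (simp add: field_simps)
  have "norm (p - damped_proj A l p) = l * norm (damped_proj A l u)"
    using damped_residual_on_normal_range[OF l u(1)] l by simp
  also have "\<dots> \<le> l * (norm e / s)"
    using damped_proj_contractive(1)[OF l, of A u] su l by (intro mult_left_mono) auto
  finally have 1: "norm (p - damped_proj A l p) \<le> l / s * norm e" by simp
  have 2: "norm ((e - p) - damped_proj A l (e - p)) \<le> \<rho> * norm e"
    using damped_proj_contractive(2)[OF l, of "e - p" A] al unfolding p_def by linarith
  have "e - damped_proj A l e = (p - damped_proj A l p) + ((e - p) - damped_proj A l (e - p))"
    by (simp add: damped_proj_diff[OF l])
  then have "norm (e - damped_proj A l e)
      \<le> norm (p - damped_proj A l p) + norm ((e - p) - damped_proj A l (e - p))"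
    by (metis norm_triangle_ineq)
  with 1 2 show ?thesis by (simp add: distrib_right)
qed

section \<open>One step of the method\<close>

text \<open>
  Subtracting the linear part along the segment leaves a curve whose velocity at time \<open>t\<close> has norm at
  most \<open>LF * t * (norm d)\<^sup>2\<close>. Comparing with the antiderivative of this bound, instead of its
  maximum, produces the factor \<open>1 / 2\<close>; without it the estimate of the error in the Polyak step would
  consume the whole decrease.
\<close>
lemma lipschitz_derivative_remainder:
  fixes F :: "'e::real_normed_vector \<Rightarrow> 'y::real_normed_vector"
  assumes DF: "\<And>x. (F has_derivative blinfun_apply (DF x)) (at x)"
    and lip: "LF-lipschitz_on UNIV DF"
  shows "norm (F (x + d) - F x - blinfun_apply (DF x) d) \<le> LF / 2 * (norm d)\<^sup>2"
proof -
  define f where "f t = F (x + t *\<^sub>R d) - t *\<^sub>R blinfun_apply (DF x) d" for t :: real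
  define \<phi> where "\<phi> t = LF / 2 * (norm d)\<^sup>2 * t\<^sup>2" for t :: real
  have line: "((\<lambda>t. x + t *\<^sub>R d) has_derivative (\<lambda>t. t *\<^sub>R d)) (at t)" for t :: real
    by (auto intro!: derivative_eq_intros)
  have f': "(f has_vector_derivative blinfun_apply (DF (x + t *\<^sub>R d) - DF x) d) (at t)" for t
    unfolding f_def has_vector_derivative_def
    by (rule has_derivative_eq_rhs,
        rule has_derivative_diff[OF has_derivative_compose[OF line DF]])
      (auto intro!: derivative_eq_intros simp: blinfun.scaleR_right blinfun.diff_left scaleR_diff_right)
  have \<phi>': "(\<phi> has_vector_derivative LF * (norm d)\<^sup>2 * t) (at t)" for t
    unfolding \<phi>_def has_real_derivative_iff_has_vector_derivative[symmetric]
    by (auto intro!: derivative_eq_intros)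
  have "norm (f 1 - f 0) \<le> \<phi> 1 - \<phi> 0"
  proof (rule differentiable_bound_general[OF zero_less_one _ _ f' \<phi>'])
    show "continuous_on {0..1} f" "continuous_on {0..1} \<phi>"
      by (rule continuous_at_imp_continuous_on, use f' \<phi>' has_vector_derivative_continuous in blast)+
  next
    fix t :: real assume t: "0 < t" "t < 1"
    have "norm (DF (x + t *\<^sub>R d) - DF x) \<le> LF * (t * norm d)"
      using lipschitz_onD[OF lip, of "x + t *\<^sub>R d" x] t by (simp add: dist_norm)
    then have "norm (DF (x + t *\<^sub>R d) - DF x) * norm d \<le> LF * (t * norm d) * norm d"
      by (intro mult_right_mono) auto
    then show "norm (blinfun_apply (DF (x + t *\<^sub>R d) - DF x) d) \<le> LF * (norm d)\<^sup>2 * t"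
      using norm_blinfun[of "DF (x + t *\<^sub>R d) - DF x" d] by (simp add: power2_eq_square ac_simps)
  qed
  then show ?thesis by (simp add: f_def \<phi>_def algebra_simps)
qed

text \<open>
  A step in the parameter space acts on the image as the subgradient step with the direction \<open>P v\<close>,
  up to the linearization error. The number \<open>a\<close> is the distance to \<open>zs\<close> after the exact
  step; the second bound adds the linearization error, where the estimate of the
  step length costs a factor \<open>1 / l\<close>.
\<close>
lemma lmm_step_decomposition:
  fixes F :: "'e::euclidean_space \<Rightarrow> 'y::euclidean_space" and x :: 'e and v zs :: 'y and g :: real
  assumes DF: "\<And>x. (F has_derivative blinfun_apply (DF x)) (at x)"
    and lip: "LF-lipschitz_on UNIV DF" and l: "l > 0"
  defines "N \<equiv> norm (orth_proj (range (blinfun_apply (DF x))) v)"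
    and "x' \<equiv> x - g *\<^sub>R damped_inverse (DF x) l (adjoint (blinfun_apply (DF x)) v)"
    and "e \<equiv> F x - zs"
  obtains a where "a \<ge> 0"
    "a\<^sup>2 \<le> (norm e)\<^sup>2 - 2 * g * inner v (damped_proj (DF x) l e) + g\<^sup>2 * N\<^sup>2"
    "norm (F x' - zs) \<le> a + LF * (g\<^sup>2 * N\<^sup>2) / (8 * l)"
proof -
  define w where "w = damped_inverse (DF x) l (adjoint (blinfun_apply (DF x)) v)"
  define r where "r = F x' - F x - blinfun_apply (DF x) (- (g *\<^sub>R w))"
  have P: "damped_proj (DF x) l v = blinfun_apply (DF x) w"
    by (simp add: damped_proj_def w_def)
  define a where "a = norm (e - g *\<^sub>R damped_proj (DF x) l v)"
  have LF: "LF \<ge> 0" using lip by (rule lipschitz_on_nonneg)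
  have "a\<^sup>2 = (norm e)\<^sup>2 - 2 * g * inner (damped_proj (DF x) l v) e
      + g\<^sup>2 * (norm (damped_proj (DF x) l v))\<^sup>2"
    unfolding a_def power2_norm_eq_inner
    by (simp add: inner_diff_left inner_diff_right inner_commute power2_eq_square algebra_simps)
  moreover have "(norm (damped_proj (DF x) l v))\<^sup>2 \<le> N\<^sup>2"
    using damped_step_bounds(2)[OF l, of "DF x" v] by (simp add: N_def power_mono)
  then have "g\<^sup>2 * (norm (damped_proj (DF x) l v))\<^sup>2 \<le> g\<^sup>2 * N\<^sup>2"
    by (intro mult_left_mono) auto
  ultimately have a2: "a\<^sup>2 \<le> (norm e)\<^sup>2 - 2 * g * inner v (damped_proj (DF x) l e) + g\<^sup>2 * N\<^sup>2"
    by (simp add: damped_proj_symmetric[OF l])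
  have "norm r \<le> LF / 2 * (norm (- (g *\<^sub>R w)))\<^sup>2"
    using lipschitz_derivative_remainder[OF DF lip, of x "- (g *\<^sub>R w)"]
    by (simp add: r_def x'_def w_def)
  also have "\<dots> = LF / 2 * (g\<^sup>2 * (norm w)\<^sup>2)" by (simp add: power_mult_distrib)
  also have "\<dots> \<le> LF / 2 * (g\<^sup>2 * (N\<^sup>2 / (4 * l)))"
    using damped_step_bounds(1)[OF l, of "DF x" v] l LF
    by (intro mult_left_mono) (simp_all add: N_def w_def field_simps)
  also have "\<dots> = LF * (g\<^sup>2 * N\<^sup>2) / (8 * l)" by simp
  finally have r: "norm r \<le> LF * (g\<^sup>2 * N\<^sup>2) / (8 * l)" .
  have "F x' - zs = (e - g *\<^sub>R damped_proj (DF x) l v) + r"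
    by (simp add: r_def e_def P blinfun.minus_right blinfun.scaleR_right)
  then have "norm (F x' - zs) \<le> a + norm r"
    unfolding a_def by (metis norm_triangle_ineq)
  with r have "norm (F x' - zs) \<le> a + LF * (g\<^sup>2 * N\<^sup>2) / (8 * l)" by linarith
  with a2 show ?thesis using that[of a] by (simp add: a_def)
qed

lemma min_value_eq:
  assumes "minimizers h F = {zs}"
  shows "min_value h F = h zs"
proof -
  have "zs \<in> range F" "\<And>z. z \<in> range F \<Longrightarrow> h zs \<le> h z"
    using assms unfolding minimizers_def is_arg_min_linorder by blast+
  then show ?thesis unfolding min_value_def
    by (intro cInf_eq_minimum) auto
qed

lemma nonsmooth_regularD:
  assumes "nonsmooth_regular h F DF zs \<mu> L"
  shows "\<mu> > 0" "L > 0" "minimizers h F = {zs}" "min_value h F = h zs"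
    and "\<mu> * norm (F x - zs) \<le> h (F x) - min_value h F"
    and "v \<in> subdifferential h (F x) \<Longrightarrow> norm (orth_proj (range (blinfun_apply (DF x))) v) \<le> L"
    and "v \<in> subdifferential h (F x) \<Longrightarrow> l > 0 \<Longrightarrow>
      \<bar>inner v ((F x - zs) - damped_proj (DF x) l (F x - zs))\<bar>
        \<le> L * norm ((F x - zs) - damped_proj (DF x) l (F x - zs))"
proof -
  note reg = assms[unfolded nonsmooth_regular_def]
  show "\<mu> > 0" "L > 0" and mins: "minimizers h F = {zs}" using reg by simp_all
  show "min_value h F = h zs" by (rule min_value_eq[OF mins])
  show "\<mu> * norm (F x - zs) \<le> h (F x) - min_value h F" using reg by simp
  show "v \<in> subdifferential h (F x) \<Longrightarrow> norm (orth_proj (range (blinfun_apply (DF x))) v) \<le> L"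
    using reg by simp
  show "v \<in> subdifferential h (F x) \<Longrightarrow> l > 0 \<Longrightarrow>
      \<bar>inner v ((F x - zs) - damped_proj (DF x) l (F x - zs))\<bar>
        \<le> L * norm ((F x - zs) - damped_proj (DF x) l (F x - zs))"
    using reg by blast
qed

text \<open>
  The direction \<open>P v\<close> is nearly as good as \<open>v\<close>: convexity gives
  \<open>inner v (F x - zs) \<ge> h (F x) - h zs\<close>, and the regularity condition on the residual bounds the
  loss from replacing \<open>F x - zs\<close> by its damped projection.
\<close>
lemma damped_inner_lower_bound:
  assumes "nonsmooth_regular h F DF zs \<mu> L" and "v \<in> subdifferential h (F x)" and "l > 0"
  shows "inner v (damped_proj (DF x) l (F x - zs))
    \<ge> (h (F x) - min_value h F) - L * norm ((F x - zs) - damped_proj (DF x) l (F x - zs))"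
proof -
  have "\<bar>inner v ((F x - zs) - damped_proj (DF x) l (F x - zs))\<bar>
      \<le> L * norm ((F x - zs) - damped_proj (DF x) l (F x - zs))"
    by (rule nonsmooth_regularD(7)[OF assms])
  moreover have "h zs \<ge> h (F x) + inner v (zs - F x)"
    using assms(2) unfolding subdifferential_def by blast
  moreover have "min_value h F = h zs"
    by (rule nonsmooth_regularD(4)[OF assms(1)])
  ultimately show ?thesis by (simp add: inner_diff_right)
qed

text \<open>
  Growth at least \<open>\<mu>\<close> and slope at most \<open>L\<close> are compatible only if \<open>\<mu>\<close> is at most a multiple of \<open>L\<close>.
  The slope is controlled on \<open>P e\<close> by the projected subgradient and on \<open>e - P e\<close> by the residual
  condition, each part contributing at most \<open>L * norm e\<close>. A point other than the minimizer and a
  subgradient there must be at hand: if \<open>F\<close> is constant, \<open>\<mu>\<close> can be arbitrarily large.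
\<close>
lemma regular_modulus_le:
  assumes reg: "nonsmooth_regular h F DF zs \<mu> L" and v: "v \<in> subdifferential h (F x)"
    and ne: "F x \<noteq> zs"
  shows "\<mu> \<le> 2 * L"
proof -
  let ?e = "F x - zs" and ?P = "damped_proj (DF x) 1"
  have L: "L > 0" and sharp: "h (F x) - min_value h F \<ge> \<mu> * norm ?e"
    and vL: "norm (orth_proj (range (blinfun_apply (DF x))) v) \<le> L"
    using nonsmooth_regularD[OF reg] v by blast+
  have "inner v (?P ?e) = inner (orth_proj (range (blinfun_apply (DF x))) v) (?P ?e)"
    by (simp add: damped_proj_def inner_orth_proj_eq subspace_range_blinfun)
  also have "\<dots> \<le> norm (orth_proj (range (blinfun_apply (DF x))) v) * norm (?P ?e)"
    by (rule norm_cauchy_schwarz)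
  also have "\<dots> \<le> L * norm ?e"
    using vL L damped_proj_contractive(1)[of 1 "DF x" ?e] by (intro mult_mono) auto
  finally have "inner v (?P ?e) \<le> L * norm ?e" .
  moreover have "L * norm (?e - ?P ?e) \<le> L * norm ?e"
    using L damped_proj_contractive(2)[of 1 ?e "DF x"] by (intro mult_left_mono) auto
  ultimately have "\<mu> * norm ?e \<le> (2 * L) * norm ?e"
    using damped_inner_lower_bound[OF reg v zero_less_one] sharp by (simp add: distrib_right)
  then show ?thesis using ne by simp
qed

text \<open>
  This is the basic recursion for both step size rules: the decrease of the squared distance is
  governed by the gap in \<open>h\<close>, less the alignment loss \<open>L * (l / s + \<rho>) * E\<close>.
\<close>
lemma aligned_lmm_step:
  fixes F :: "'e::euclidean_space \<Rightarrow> 'y::euclidean_space" and x :: 'e and v zs :: 'y and g :: real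
  assumes DF: "\<And>x. (F has_derivative blinfun_apply (DF x)) (at x)"
    and svd: "\<And>x. is_svd (DF x) (\<sigma> x) (U x) (V x)"
    and lip: "LF-lipschitz_on UNIV DF"
    and reg: "nonsmooth_regular h F DF zs \<mu> L"
    and al: "strongly_aligned F \<sigma> U zs \<delta> s"
    and \<rho>: "\<rho> > 0" "norm (F x - zs) \<le> \<delta> \<rho>"
    and l: "l > 0" and g: "g > 0" and v: "v \<in> subdifferential h (F x)"
  defines "N \<equiv> norm (orth_proj (range (blinfun_apply (DF x))) v)"
    and "x' \<equiv> x - g *\<^sub>R damped_inverse (DF x) l (adjoint (blinfun_apply (DF x)) v)"
    and "E \<equiv> norm (F x - zs)"
  obtains a where "a \<ge> 0"
    "a\<^sup>2 \<le> E\<^sup>2 - 2 * g * ((h (F x) - min_value h F) - L * ((l / s + \<rho>) * E)) + g\<^sup>2 * N\<^sup>2"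
    "norm (F x' - zs) \<le> a + LF * (g\<^sup>2 * N\<^sup>2) / (8 * l)"
proof -
  let ?e = "F x - zs"
  have "F x \<in> cball zs (\<delta> \<rho>)" using \<rho>(2) by (simp add: dist_norm norm_minus_commute)
  then obtain j where j: "j \<in> {1..min DIM('e) DIM('y)}"
    "norm (?e - orth_proj (span (U x ` {1..j})) ?e) \<le> \<rho> * norm ?e" "(\<sigma> x j)\<^sup>2 \<ge> s"
    using al \<rho>(1) unfolding strongly_aligned_def by blast
  have s: "s > 0" using al unfolding strongly_aligned_def by blast
  have "norm (?e - damped_proj (DF x) l ?e) \<le> (l / s + \<rho>) * E"
    unfolding E_def by (rule aligned_residual_bound[OF svd j(1) s j(3) l j(2)])
  moreover have "L > 0" by (rule nonsmooth_regularD(2)[OF reg])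
  ultimately have "L * norm (?e - damped_proj (DF x) l ?e) \<le> L * ((l / s + \<rho>) * E)"
    by (intro mult_left_mono) auto
  then have "inner v (damped_proj (DF x) l ?e) \<ge> (h (F x) - min_value h F) - L * ((l / s + \<rho>) * E)"
    using damped_inner_lower_bound[OF reg v l] by linarith
  then have "2 * g * inner v (damped_proj (DF x) l ?e)
      \<ge> 2 * g * ((h (F x) - min_value h F) - L * ((l / s + \<rho>) * E))"
    using g by (intro mult_left_mono) auto
  moreover obtain a where "a \<ge> 0"
    "a\<^sup>2 \<le> E\<^sup>2 - 2 * g * inner v (damped_proj (DF x) l ?e) + g\<^sup>2 * N\<^sup>2"
    "norm (F x' - zs) \<le> a + LF * (g\<^sup>2 * N\<^sup>2) / (8 * l)"
    using lmm_step_decomposition[OF DF lip l, where x = x and v = v and g = g and zs = zs]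
    unfolding N_def x'_def E_def by metis
  ultimately show ?thesis using that[of a] by linarith
qed

section \<open>The Polyak step size\<close>

text \<open>
  The linearization error is measured against \<open>g / E\<close>, where \<open>g / 2\<close> is the decrease of the squared
  distance in the exact step. Its cross term with \<open>a \<le> E\<close> costs \<open>g / 4\<close> and its square
  \<open>g / 32\<close>, because \<open>g \<le> 2 * E\<^sup>2\<close>; so at least \<open>g / 8\<close> of the decrease survives.
\<close>
lemma polyak_contraction:
  fixes E a r \<gamma> :: real
  assumes E: "E > 0" and a: "a \<ge> 0" and b: "a\<^sup>2 \<le> E\<^sup>2 - g / 2" and r: "r \<le> g / (8 * E)" and e: "e \<ge> 0" "e \<le> a + r" and g: "g \<ge> 0"
  shows "e\<^sup>2 \<le> E\<^sup>2 - g / 8"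
proof -
  define t where "t = g / (8 * E)"
  have t: "t \<ge> 0" "g = 8 * E * t" using E g by (simp_all add: t_def)
  have "a\<^sup>2 \<le> E\<^sup>2" using b g by linarith
  then have aE: "a \<le> E" by (rule power2_le_imp_le) (use E in simp)
  have "0 \<le> E\<^sup>2 - 4 * (E * t)"
    using b t(2) zero_le_power2[of a] by linarith
  then have "0 \<le> E * (E - 4 * t)" by (simp add: power2_eq_square algebra_simps)
  then have tE: "4 * t \<le> E" using E by (simp add: zero_le_mult_iff)
  have "e \<le> a + t" using e r by (simp add: t_def)
  then have "e\<^sup>2 \<le> (a + t)\<^sup>2" using e(1) by (rule power_mono)
  also have "\<dots> = a\<^sup>2 + 2 * (a * t) + t * t" by (simp add: power2_eq_square algebra_simps)
  also have "\<dots> \<le> (E\<^sup>2 - g / 2) + 2 * (E * t) + E / 4 * t"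
    using b aE tE t(1) by (intro add_mono mult_left_mono mult_right_mono) auto
  also have "\<dots> \<le> E\<^sup>2 - g / 8" using t E by simp
  finally show ?thesis .
qed

text \<open>
  With the Polyak step size, the decrease is a multiple of \<open>G = g * \<Delta> = \<gamma> * \<Delta>\<^sup>2 / N\<^sup>2\<close>. The closeness
  assumption makes \<open>l / s\<close> as small as the alignment parameter \<open>\<mu> / (8 * L)\<close>, so that the alignment
  loss consumes at most a quarter of the gap \<open>\<Delta>\<close>. As the damping is proportional to the distance \<open>E\<close>, the
  linearization error is at most \<open>G / (8 * E)\<close>. Finally \<open>\<Delta> \<ge> \<mu> * E\<close> and \<open>N \<le> L\<close> turn the decrease
  into a fixed fraction of \<open>E\<^sup>2\<close>.

  That the iterate is not yet the minimizer is part of the conclusion: positive damping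
  that is bounded by a multiple of the distance forces this.
\<close>
lemma polyak_step:
  fixes F :: "'e::euclidean_space \<Rightarrow> 'y::euclidean_space"
  assumes DF: "\<And>x. (F has_derivative blinfun_apply (DF x)) (at x)"
    and svd: "\<And>x. is_svd (DF x) (\<sigma> x) (U x) (V x)"
    and lip: "LF-lipschitz_on UNIV DF"
    and reg: "nonsmooth_regular h F DF zs \<mu> L"
    and al: "strongly_aligned F \<sigma> U zs \<delta> s"
    and near: "norm (F x - zs) \<le> \<delta> (\<mu> / (8 * L))" "norm (F x - zs) \<le> s * \<mu> / (8 * Cub * L)"
    and v: "v \<in> subdifferential h (F x)"
    and g: "g = \<gamma> * ((h (F x) - min_value h F) / (norm (orth_proj (range (blinfun_apply (DF x))) v))\<^sup>2)" "g > 0"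
    and l: "Clb * norm (F x - zs) \<le> l" "l \<le> Cub * norm (F x - zs)" "l > 0"
    and C: "0 < Clb" "Clb \<le> Cub" and \<gamma>: "0 < \<gamma>" "\<gamma> \<le> 1" "LF * \<gamma> \<le> Clb"
  defines "x' \<equiv> x - g *\<^sub>R damped_inverse (DF x) l (adjoint (blinfun_apply (DF x)) v)"
  shows "0 < norm (F x - zs)"
    and "(norm (F x' - zs))\<^sup>2 \<le> (1 - \<gamma> * \<mu>\<^sup>2 / (8 * L\<^sup>2)) * (norm (F x - zs))\<^sup>2"
proof -
  define E N \<Delta> where "E = norm (F x - zs)"
    and "N = norm (orth_proj (range (blinfun_apply (DF x))) v)" and "\<Delta> = h (F x) - min_value h F"
  have \<mu>: "\<mu> > 0" and L: "L > 0" and sharp: "\<mu> * E \<le> \<Delta>" and NL: "N \<le> L"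
    using nonsmooth_regularD[OF reg] v unfolding E_def \<Delta>_def N_def by simp_all
  have s: "s > 0" using al unfolding strongly_aligned_def by blast
  have "F x \<noteq> zs" using l by auto
  then have E: "E > 0" by (simp add: E_def)
  then show "0 < norm (F x - zs)" by (simp add: E_def)
  have N: "N > 0"
    using g unfolding N_def by (cases "orth_proj (range (blinfun_apply (DF x))) v = 0") auto
  have LF: "LF \<ge> 0" using lip by (rule lipschitz_on_nonneg)
  have \<Delta>: "\<Delta> > 0" using sharp \<mu> E mult_pos_pos[of \<mu> E] by linarith
  define G where "G = g * \<Delta>"
  have gN: "g * N\<^sup>2 = \<gamma> * \<Delta>" using g(1) N by (simp add: N_def \<Delta>_def)
  have G0: "G > 0" unfolding G_def by (rule mult_pos_pos[OF g(2) \<Delta>])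
  have g2N: "g\<^sup>2 * N\<^sup>2 = \<gamma> * G" using gN by (simp add: G_def power2_eq_square ac_simps)
  have \<rho>: "\<mu> / (8 * L) > 0" using \<mu> L by simp
  obtain a where a: "a \<ge> 0"
    "a\<^sup>2 \<le> E\<^sup>2 - 2 * g * (\<Delta> - L * ((l / s + \<mu> / (8 * L)) * E)) + g\<^sup>2 * N\<^sup>2"
    "norm (F x' - zs) \<le> a + LF * (g\<^sup>2 * N\<^sup>2) / (8 * l)"
    unfolding E_def N_def \<Delta>_def x'_def
    by (rule aligned_lmm_step[OF DF svd lip reg al \<rho> near(1) l(3) g(2) v])
  have "l \<le> Cub * (s * \<mu> / (8 * Cub * L))"
    by (rule order_trans[OF l(2) mult_left_mono[OF near(2)]]) (use C in simp)
  also have "\<dots> = s * \<mu> / (8 * L)" using C by simp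
  finally have "l / s \<le> \<mu> / (8 * L)" using s by (simp add: field_simps)
  then have "L * ((l / s + \<mu> / (8 * L)) * E) \<le> L * ((\<mu> / (8 * L) + \<mu> / (8 * L)) * E)"
    using E L by (intro mult_left_mono mult_right_mono) auto
  also have "\<dots> = \<mu> * E / 4" using L by simp
  finally have "3 / 4 * \<Delta> \<le> \<Delta> - L * ((l / s + \<mu> / (8 * L)) * E)" using sharp by linarith
  then have "2 * g * (3 / 4 * \<Delta>) \<le> 2 * g * (\<Delta> - L * ((l / s + \<mu> / (8 * L)) * E))"
    using g(2) by (intro mult_left_mono) auto
  moreover have "\<gamma> * G \<le> 1 * G" using \<gamma>(2) G0 by (intro mult_right_mono) auto
  moreover have "2 * g * (3 / 4 * \<Delta>) = 3 / 2 * G" by (simp add: G_def)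
  ultimately have a2: "a\<^sup>2 \<le> E\<^sup>2 - G / 2" using a(2) unfolding g2N by linarith
  have "LF * \<gamma> * G / (8 * l) \<le> Clb * G / (8 * (Clb * E))"
    using \<gamma> l C G0 E LF by (intro frac_le mult_right_mono) (auto simp: E_def)
  also have "\<dots> = G / (8 * E)" using C by simp
  finally have r: "LF * (g\<^sup>2 * N\<^sup>2) / (8 * l) \<le> G / (8 * E)" by (simp add: g2N mult.assoc)
  have "(norm (F x' - zs))\<^sup>2 \<le> E\<^sup>2 - G / 8"
    by (rule polyak_contraction[OF E a(1) a2 r _ a(3)]) (use G0 in auto)
  moreover have "\<gamma> * (\<mu>\<^sup>2 / L\<^sup>2 * E\<^sup>2) \<le> G"
  proof -
    have "(\<mu> * E)\<^sup>2 \<le> \<Delta>\<^sup>2" using sharp \<mu> E by (intro power_mono) auto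
    moreover have "N\<^sup>2 \<le> L\<^sup>2" using NL N by (intro power_mono) auto
    ultimately have "(\<mu> * E)\<^sup>2 / L\<^sup>2 \<le> \<Delta>\<^sup>2 / N\<^sup>2"
      using N by (intro frac_le) auto
    then have "\<gamma> * ((\<mu> * E)\<^sup>2 / L\<^sup>2) \<le> \<gamma> * (\<Delta>\<^sup>2 / N\<^sup>2)" using \<gamma> by (intro mult_left_mono) auto
    also have "\<dots> = G" using g(1) by (simp add: G_def N_def \<Delta>_def power2_eq_square)
    finally show ?thesis by (simp add: power_mult_distrib)
  qed
  ultimately show "(norm (F x' - zs))\<^sup>2 \<le> (1 - \<gamma> * \<mu>\<^sup>2 / (8 * L\<^sup>2)) * (norm (F x - zs))\<^sup>2"
    by (simp add: E_def[symmetric] algebra_simps)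
qed

section \<open>The geometrically decaying step size\<close>

text \<open>
  All distances are divided by the current radius \<open>M * Q\<close>, so \<open>t\<close> is the relative distance to the
  minimizer. The iterates need not approach the minimizer in every step: far from it
  (\<open>t > 1 / 2\<close>) the decrease beats the shrinking of the radius, and near it (\<open>t \<le> 1 / 2\<close>) the
  step is too short to leave the smaller ball, whose relative radius is at least
  \<open>1 / sqrt 2\<close>.
\<close>
lemma geometric_contraction:
  fixes t a r G e q :: real
  assumes t: "0 \<le> t" "t \<le> 1" and G: "0 \<le> G" "G \<le> 1 / 16"
    and a: "a \<ge> 0" "a\<^sup>2 \<le> t\<^sup>2 - 27 / 16 * G * t + G / 64"
    and r: "r \<le> G / 16" and q: "q \<ge> 1 - G / 4" "q \<ge> 1 / sqrt 2"
  shows "a + r \<le> q"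
proof (cases "t \<le> 1 / 2")
  case True
  have "t\<^sup>2 \<le> (1 / 2)\<^sup>2" using True t by (intro power_mono) auto
  moreover have "0 \<le> G * t" using G t by simp
  ultimately have "a\<^sup>2 \<le> (0.6 :: real)\<^sup>2" using a(2) G by (simp add: power2_eq_square)
  then have "a \<le> 0.6" by (rule power2_le_imp_le) simp
  moreover have "(0.7 :: real) \<le> 1 / sqrt 2"
  proof -
    have "sqrt 2 \<le> 10 / 7" by (rule real_le_lsqrt) (simp_all add: power2_eq_square)
    then show ?thesis by (simp add: field_simps)
  qed
  ultimately show ?thesis using r q(2) G by simp
next
  case False
  \<comment> \<open>The bound on the square of \<open>a\<close> is convex in \<open>t\<close>; on the interval from \<open>1 / 2\<close> to \<open>1\<close> it is replaced by a chord.\<close>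
  have "(t - 1 / 2) * (1 - t) \<ge> 0" using False t by simp
  moreover have "(t - 1 / 2) * (1 - t) = 3 / 2 * t - 1 / 2 - t\<^sup>2"
    by (simp add: power2_eq_square field_simps)
  ultimately have "t\<^sup>2 \<le> 3 / 2 * t - 1 / 2" by linarith
  moreover have "3 / 2 * t - 1 / 2 - 27 / 16 * G * t + G / 64 \<le> 1 - 5 / 8 * G"
  proof -
    have "0 \<le> (1 - t) * (3 / 2 - 27 / 16 * G)" using t G by (intro mult_nonneg_nonneg) auto
    moreover have "(1 - t) * (3 / 2 - 27 / 16 * G) = 3 / 2 - 3 / 2 * t - 27 / 16 * G + 27 / 16 * G * t"
      by (simp add: field_simps)
    ultimately show ?thesis using G by linarith
  qed
  ultimately have "a\<^sup>2 \<le> 1 - 5 / 8 * G" using a(2) by linarith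
  also have "\<dots> \<le> (1 - 5 / 16 * G)\<^sup>2" by (simp add: power2_eq_square algebra_simps)
  finally have "a \<le> 1 - 5 / 16 * G" by (rule power2_le_imp_le) (use G in simp)
  then show ?thesis using r q(1) by simp
qed

text \<open>
  Rescaling by the radius \<open>M * Q\<close> removes the iteration index, because step size and damping decay
  at the same rate as the radius; the step size then enters only through \<open>G = \<gamma> * \<mu> / M\<close>. Here
  \<open>\<mu> \<le> 2 * L\<close> and the bound on \<open>\<gamma>\<close> give \<open>G \<le> 1 / 16\<close>.
\<close>
lemma geometric_step:
  fixes F :: "'e::euclidean_space \<Rightarrow> 'y::euclidean_space"
  assumes DF: "\<And>x. (F has_derivative blinfun_apply (DF x)) (at x)"
    and svd: "\<And>x. is_svd (DF x) (\<sigma> x) (U x) (V x)"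
    and lip: "LF-lipschitz_on UNIV DF"
    and reg: "nonsmooth_regular h F DF zs \<mu> L"
    and al: "strongly_aligned F \<sigma> U zs \<delta> s"
    and v: "v \<in> subdifferential h (F x)" and pos: "\<gamma> > 0" "l > 0" and Q: "0 < Q" "Q \<le> 1"
    and near: "norm (F x - zs) \<le> M * Q" and M: "M = \<delta> (\<mu> / (8 * L))"
    and l: "l \<le> s / 32 * (\<mu> / L)"
    and \<gamma>: "\<gamma> \<le> 1 / L * (M * \<mu> / (64 * L))" "2 * LF * L\<^sup>2 * \<gamma> \<le> l * \<mu>"
    and q: "q \<ge> 1 - \<gamma> * \<mu> / (4 * M)" "q \<ge> 1 / sqrt 2" and \<mu>L: "\<mu> \<le> 2 * L"
  defines "x' \<equiv> x - (\<gamma> * Q) *\<^sub>R damped_inverse (DF x) (l * Q) (adjoint (blinfun_apply (DF x)) v)"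
  shows "norm (F x' - zs) \<le> M * (q * Q)"
proof -
  define E N \<Delta> where "E = norm (F x - zs)"
    and "N = norm (orth_proj (range (blinfun_apply (DF x))) v)" and "\<Delta> = h (F x) - min_value h F"
  have \<mu>: "\<mu> > 0" and L: "L > 0" and sharp: "\<mu> * E \<le> \<Delta>" and NL: "N \<le> L" and N: "N \<ge> 0"
    using nonsmooth_regularD[OF reg] v unfolding E_def \<Delta>_def N_def by simp_all
  have s: "s > 0" and M0: "M > 0"
    using al \<mu> L unfolding strongly_aligned_def M by auto
  have E0: "E \<ge> 0" by (simp add: E_def)
  have LF: "LF \<ge> 0" using lip by (rule lipschitz_on_nonneg)
  have "M * Q \<le> M" using M0 Q by simp
  then have inside: "norm (F x - zs) \<le> \<delta> (\<mu> / (8 * L))" using near M by linarith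
  have \<rho>: "\<mu> / (8 * L) > 0" and lQ0: "l * Q > 0" and gQ0: "\<gamma> * Q > 0" using \<mu> L pos Q by simp_all
  obtain a where a: "a \<ge> 0"
    "a\<^sup>2 \<le> E\<^sup>2 - 2 * (\<gamma> * Q) * (\<Delta> - L * ((l * Q / s + \<mu> / (8 * L)) * E)) + (\<gamma> * Q)\<^sup>2 * N\<^sup>2"
    "norm (F x' - zs) \<le> a + LF * ((\<gamma> * Q)\<^sup>2 * N\<^sup>2) / (8 * (l * Q))"
    unfolding E_def N_def \<Delta>_def x'_def
    by (rule aligned_lmm_step[OF DF svd lip reg al \<rho> inside lQ0 gQ0 v])
  define G t where "G = \<gamma> * \<mu> / M" and "t = E / (M * Q)"
  have G0: "G \<ge> 0" using pos \<mu> M0 by (simp add: G_def)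
  have N2: "N\<^sup>2 \<le> L\<^sup>2" using NL N by (intro power_mono) auto
  have \<gamma>L: "64 * (\<gamma> * L\<^sup>2) \<le> M * \<mu>"
    using \<gamma>(1) L by (simp add: field_simps power2_eq_square)
  have "G * 64 * L\<^sup>2 \<le> \<mu>\<^sup>2"
    using mult_right_mono[OF \<gamma>L, of \<mu>] \<mu> M0 by (simp add: G_def field_simps power2_eq_square)
  also have "\<dots> \<le> (2 * L)\<^sup>2" using \<mu>L \<mu> by (intro power_mono) auto
  finally have G1: "G \<le> 1 / 16" using L by (simp add: power_mult_distrib)
  have "l * Q \<le> s / 32 * (\<mu> / L)"
    using l Q pos mult_left_le[of Q l] by linarith
  then have lQ: "l * Q / s \<le> \<mu> / (32 * L)" using s by (simp add: field_simps)
  have "L * ((l * Q / s + \<mu> / (8 * L)) * E) \<le> L * ((\<mu> / (32 * L) + \<mu> / (8 * L)) * E)"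
    using E0 L lQ by (intro mult_left_mono mult_right_mono) auto
  also have "\<dots> = 5 / 32 * (\<mu> * E)" using L by (simp add: field_simps)
  \<comment> \<open>Of \<open>\<mu> * E\<close>, at most \<open>1 / 8\<close> is lost to misalignment and \<open>1 / 32\<close> to damping.\<close>
  finally have "27 / 32 * (\<mu> * E) \<le> \<Delta> - L * ((l * Q / s + \<mu> / (8 * L)) * E)" using sharp by linarith
  then have "2 * (\<gamma> * Q) * (27 / 32 * (\<mu> * E))
      \<le> 2 * (\<gamma> * Q) * (\<Delta> - L * ((l * Q / s + \<mu> / (8 * L)) * E))"
    using pos Q by (intro mult_left_mono) auto
  moreover have "(\<gamma> * Q)\<^sup>2 * N\<^sup>2 \<le> (M * Q)\<^sup>2 * (G / 64)"
  proof -
    have "(\<gamma> * Q)\<^sup>2 * N\<^sup>2 \<le> (\<gamma> * Q)\<^sup>2 * L\<^sup>2" using N2 by (intro mult_left_mono) auto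
    also have "\<dots> = (\<gamma> * Q\<^sup>2) * (\<gamma> * L\<^sup>2)" by (simp add: power2_eq_square)
    also have "\<dots> \<le> (\<gamma> * Q\<^sup>2) * (M * \<mu> / 64)" using \<gamma>L pos by (intro mult_left_mono) auto
    also have "\<dots> = (M * Q)\<^sup>2 * (G / 64)" using M0 by (simp add: G_def power2_eq_square)
    finally show ?thesis .
  qed
  moreover have "2 * (\<gamma> * Q) * (27 / 32 * (\<mu> * E)) = (M * Q)\<^sup>2 * (27 / 16 * G * t)"
    and E2: "E\<^sup>2 = (M * Q)\<^sup>2 * t\<^sup>2"
    using M0 Q by (simp_all add: G_def t_def power2_eq_square)
  ultimately have "a\<^sup>2 \<le> (M * Q)\<^sup>2 * (t\<^sup>2 - 27 / 16 * G * t + G / 64)"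
    using a(2) by (simp add: algebra_simps)
  then have a2: "(a / (M * Q))\<^sup>2 \<le> t\<^sup>2 - 27 / 16 * G * t + G / 64"
    using M0 Q by (simp add: power_divide pos_divide_le_eq mult.commute)
  define r where "r = LF * ((\<gamma> * Q)\<^sup>2 * N\<^sup>2) / (8 * (l * Q))"
  have "r \<le> LF * ((\<gamma> * Q)\<^sup>2 * L\<^sup>2) / (8 * (l * Q))"
    unfolding r_def using LF N2 pos Q by (intro divide_right_mono mult_left_mono) auto
  also have "\<dots> = (\<gamma> * Q) * (2 * LF * L\<^sup>2 * \<gamma>) / (16 * l)"
    using Q pos by (simp add: power2_eq_square)
  also have "\<dots> \<le> (\<gamma> * Q) * (l * \<mu>) / (16 * l)"
    using \<gamma>(2) pos Q by (intro divide_right_mono mult_left_mono) auto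
  also have "\<dots> = (M * Q) * (G / 16)" using pos M0 by (simp add: G_def)
  finally have r: "r / (M * Q) \<le> G / 16" using M0 Q by (simp add: pos_divide_le_eq mult.commute)
  have "a / (M * Q) + r / (M * Q) \<le> q"
    by (rule geometric_contraction[OF _ _ G0 G1 _ a2 r])
      (use q a(1) near M0 Q E0 in \<open>auto simp: t_def E_def G_def pos_divide_le_eq\<close>)
  then have "a + r \<le> M * (q * Q)"
    using M0 Q by (simp add: add_divide_distrib[symmetric] pos_divide_le_eq ac_simps)
  then show ?thesis using a(3) by (simp add: r_def)
qed

lemma ereal_le_quotient_imp:
  assumes "ereal a \<le> ereal b / ereal c" "c \<ge> 0" "b > 0"
  shows "c * a \<le> b"
proof (cases "c = 0")
  case True
  then show ?thesis using assms by simp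
next
  case False
  then show ?thesis using assms by (simp add: field_simps)
qed

section \<open>Linear convergence\<close>

theorem theorem4p4:
  fixes h :: "'y::euclidean_space \<Rightarrow> real"
    and F :: "'e::euclidean_space \<Rightarrow> 'y"
    and DF :: "'e \<Rightarrow> 'e \<Rightarrow>\<^sub>L 'y"
    and \<sigma> :: "'e \<Rightarrow> nat \<Rightarrow> real" and U :: "'e \<Rightarrow> nat \<Rightarrow> 'y" and V :: "'e \<Rightarrow> nat \<Rightarrow> 'e"
    and \<delta> :: "real \<Rightarrow> real" and s \<mu> L LF :: real
    and zs :: 'y and x0 :: 'e
  assumes "continuously_differentiable_with F DF"
    and "\<And>x. is_svd (DF x) (\<sigma> x) (U x) (V x)"
    and "LF-lipschitz_on UNIV DF"
    and "nonsmooth_regular h F DF zs \<mu> L"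
    and "strongly_aligned F \<sigma> U zs \<delta> s"
    and "norm (F x0 - zs) \<le> \<delta> (\<mu> / (8 * L))"
  shows "(\<forall>\<gamma> Clb Cub gam lam v x.
            lmm_sequence h F DF x0 gam lam v x \<longrightarrow>
            polyak_configuration h F DF \<gamma> Clb Cub gam lam v x \<longrightarrow>
            ereal \<gamma> \<le> min 1 (ereal Clb / ereal LF) \<longrightarrow>
            norm (F x0 - zs) \<le> s * \<mu> / (8 * Cub * L) \<longrightarrow>
            (\<forall>k. (norm (F (x k) - zs))\<^sup>2
                   \<le> (1 - \<gamma> * \<mu>\<^sup>2 / (8 * L\<^sup>2)) ^ k * (norm (F x0 - zs))\<^sup>2))
       \<and> (let M = \<delta> (\<mu> / (8 * L)) in
          \<forall>\<gamma> l q v x.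
            \<gamma> > 0 \<longrightarrow> l > 0 \<longrightarrow> 0 < q \<longrightarrow> q < 1 \<longrightarrow>
            lmm_sequence h F DF x0 (\<lambda>k. \<gamma> * q ^ k) (\<lambda>k. l * q ^ k) v x \<longrightarrow>
            l \<le> s / 32 * (\<mu> / L) \<longrightarrow>
            ereal \<gamma> \<le> ereal (1 / L) *
              min (ereal (M * \<mu> / (64 * L)))
                (min (ereal_sqrt (ereal (2 * l * M) / ereal LF))
                     (ereal (l * \<mu>) / ereal (2 * LF * L))) \<longrightarrow>
            q \<ge> max (1 - \<gamma> * \<mu> / (4 * M)) (1 / sqrt 2) \<longrightarrow>
            (\<forall>k. norm (F (x k) - zs) \<le> M * q ^ k))"
proof -
  have DF: "(F has_derivative blinfun_apply (DF x)) (at x)" for x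
    using assms(1) unfolding continuously_differentiable_with_def by blast
  note svd = assms(2) and lip = assms(3) and reg = assms(4) and al = assms(5)
  have LF: "LF \<ge> 0" using lip by (rule lipschitz_on_nonneg)
  have \<mu>: "\<mu> > 0" and L: "L > 0" and mins: "minimizers h F = {zs}"
    using nonsmooth_regularD[OF reg] by blast+
  have dist: "infdist z (minimizers h F) = norm (z - zs)" for z
    by (simp add: mins dist_norm)
  have polyak: "(norm (F (x k) - zs))\<^sup>2 \<le> (1 - \<gamma> * \<mu>\<^sup>2 / (8 * L\<^sup>2)) ^ k * (norm (F x0 - zs))\<^sup>2"
    if seq: "lmm_sequence h F DF x0 gam lam v x"
      and conf: "polyak_configuration h F DF \<gamma> Clb Cub gam lam v x"
      and \<gamma>le: "ereal \<gamma> \<le> min 1 (ereal Clb / ereal LF)"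
      and close: "norm (F x0 - zs) \<le> s * \<mu> / (8 * Cub * L)"
    for \<gamma> Clb Cub gam lam v x k
  proof -
    let ?c = "1 - \<gamma> * \<mu>\<^sup>2 / (8 * L\<^sup>2)"
    have \<gamma>0: "\<gamma> > 0" and C: "0 < Clb" "Clb \<le> Cub"
      using conf unfolding polyak_configuration_def by auto
    have \<gamma>1: "\<gamma> \<le> 1" using \<gamma>le by simp
    have \<gamma>2: "LF * \<gamma> \<le> Clb" by (rule ereal_le_quotient_imp[OF _ LF C(1)]) (use \<gamma>le in simp)
    have c1: "?c \<le> 1" using \<gamma>0 by simp
    have "(norm (F (x k) - zs))\<^sup>2 \<le> ?c ^ k * (norm (F x0 - zs))\<^sup>2
        \<and> norm (F (x k) - zs) \<le> norm (F x0 - zs)"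
    proof (induction k)
      case 0
      then show ?case using seq by (simp add: lmm_sequence_def)
    next
      case (Suc k)
      let ?E = "norm (F (x k) - zs)" and ?E' = "norm (F (x (Suc k)) - zs)"
      have step: "x (Suc k) = x k - gam k *\<^sub>R
          damped_inverse (DF (x k)) (lam k) (adjoint (blinfun_apply (DF (x k))) (v k))"
        and v: "v k \<in> subdifferential h (F (x k))" and pos: "gam k > 0" "lam k > 0"
        using seq unfolding lmm_sequence_def by auto
      have g: "gam k = \<gamma> * ((h (F (x k)) - min_value h F) /
            (norm (orth_proj (range (blinfun_apply (DF (x k)))) (v k)))\<^sup>2)"
        and l: "Clb * ?E \<le> lam k" "lam k \<le> Cub * ?E"
        using conf unfolding polyak_configuration_def dist by auto
      have near: "?E \<le> \<delta> (\<mu> / (8 * L))" "?E \<le> s * \<mu> / (8 * Cub * L)"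
        using Suc.IH assms(6) close by auto
      note ps = polyak_step[OF DF svd lip reg al near v g pos(1) l pos(2) C \<gamma>0 \<gamma>1 \<gamma>2,
          folded step]
      \<comment> \<open>Chaining the contractions needs a nonnegative factor; the step itself supplies this.\<close>
      have "0 \<le> ?c * ?E\<^sup>2" using ps(2) zero_le_power2 order_trans by blast
      then have c0: "0 \<le> ?c" using ps(1) by (simp add: zero_le_mult_iff)
      have "?E'\<^sup>2 \<le> ?c * (?c ^ k * (norm (F x0 - zs))\<^sup>2)"
        using ps(2) mult_left_mono[OF conjunct1[OF Suc.IH] c0] by linarith
      moreover have "?c * ?E\<^sup>2 \<le> ?E\<^sup>2" using mult_right_mono[OF c1 zero_le_power2, of ?E] by simp
      then have "?E'\<^sup>2 \<le> ?E\<^sup>2" using ps(2) by linarith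
      then have "?E' \<le> ?E" by (rule power2_le_imp_le) simp
      ultimately show ?case using Suc.IH by (simp add: mult.assoc)
    qed
    then show ?thesis by blast
  qed
  define M where "M = \<delta> (\<mu> / (8 * L))"
  have geometric: "norm (F (x k) - zs) \<le> M * q ^ k"
    if pos: "\<gamma> > 0" "l > 0" and q01: "0 < q" "q < 1"
      and seq: "lmm_sequence h F DF x0 (\<lambda>k. \<gamma> * q ^ k) (\<lambda>k. l * q ^ k) v x"
      and l: "l \<le> s / 32 * (\<mu> / L)"
      and \<gamma>le: "ereal \<gamma> \<le> ereal (1 / L) * min (ereal (M * \<mu> / (64 * L)))
          (min (ereal_sqrt (ereal (2 * l * M) / ereal LF)) (ereal (l * \<mu>) / ereal (2 * LF * L)))"
      and q: "q \<ge> max (1 - \<gamma> * \<mu> / (4 * M)) (1 / sqrt 2)"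
    for \<gamma> l q v x k
  proof -
    have bound: "ereal \<gamma> \<le> ereal (1 / L) * b"
      if "min (ereal (M * \<mu> / (64 * L)))
          (min (ereal_sqrt (ereal (2 * l * M) / ereal LF)) (ereal (l * \<mu>) / ereal (2 * LF * L))) \<le> b"
      for b
      using \<gamma>le L by (rule_tac order_trans[OF _ ereal_mult_left_mono[OF that]]) auto
    have "ereal \<gamma> \<le> ereal (1 / L) * ereal (M * \<mu> / (64 * L))" by (rule bound) simp
    then have \<gamma>1: "\<gamma> \<le> 1 / L * (M * \<mu> / (64 * L))" by simp
    have b3: "ereal \<gamma> \<le> ereal (1 / L) * (ereal (l * \<mu>) / ereal (2 * LF * L))"
      by (rule bound[OF min.coboundedI2[OF min.cobounded2]])
    have \<gamma>2: "2 * LF * L\<^sup>2 * \<gamma> \<le> l * \<mu>"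
    proof (cases "LF = 0")
      case True
      then show ?thesis using pos \<mu> by simp
    next
      case False
      then show ?thesis using b3 LF L by (simp add: field_simps power2_eq_square)
    qed
    show ?thesis
    proof (induction k)
      case 0
      then show ?case using seq assms(6) by (simp add: lmm_sequence_def M_def)
    next
      case (Suc k)
      have step: "x (Suc k) = x k - (\<gamma> * q ^ k) *\<^sub>R
          damped_inverse (DF (x k)) (l * q ^ k) (adjoint (blinfun_apply (DF (x k))) (v k))"
        and v: "v k \<in> subdifferential h (F (x k))"
          "v (Suc k) \<in> subdifferential h (F (x (Suc k)))"
        using seq unfolding lmm_sequence_def by blast+
      show ?case
      proof (cases "F (x (Suc k)) = zs")
        case True
        have "M > 0" using al \<mu> L unfolding strongly_aligned_def M_def by simp
        then show ?thesis using True q01 by simp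
      next
        case False
        \<comment> \<open>The new iterate, rather than the old one, provides the subgradient away from the minimizer:
            the old one may be the minimizer, while for the new one that case is already settled.\<close>
        have \<mu>L: "\<mu> \<le> 2 * L" by (rule regular_modulus_le[OF reg v(2) False])
        have "0 < q ^ k" "q ^ k \<le> 1" using q01 by (simp_all add: power_le_one)
        then show ?thesis
          using geometric_step[OF DF svd lip reg al v(1) pos _ _ Suc.IH M_def l \<gamma>1 \<gamma>2 _ _ \<mu>L] q
          by (simp add: step)
      qed
    qed
  qed
  show ?thesis
    unfolding Let_def M_def[symmetric] using polyak geometric by blast
qed

end
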